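(* Let $n$ be a positive integer and $k$ an integer. Let $\sigma=\sigma_1\cdots\sigma_{3n}$ be the output of the right-to-left sweep map applied to a $(2n,n)$-Dyck path, and let $\tau=(\tau_1,\dots,\tau_{3n})$ be the corresponding rank sequence. Suppose that for some index $i$ we have $\sigma_i = \mathrm{W}$, $\tau_i = kn$, and $\sigma_{i+1}=\mathrm{S}$. Then $\tau_{i+1}=kn$. Moreover, if in addition $\sigma_{i+2}=\mathrm{S}$, then $\tau_{i+2}=kn$ as well.
   Context: A $(2n,n)$-Dyck path is a sequence of $3n$ steps, $n$ of which are north steps and $2n$ of which are east steps, together with the following levels. Each lattice point of the path has a level: the starting point has level $0$, a north step raises the level by $2n$, an east step lowers the level by $n$. The path is required never to reach a negative level, so it begins and ends at level $0$. The level of a north step is the level of its starting point, called its south endpoint, labelled S. The level of an east step is the level of its starting point, called its west endpoint, labelled W. The right-to-left sweep map lists the $3n$ steps in nondecreasing order of level. Among steps of equal level, the step occurring later in the path is listed first. The output is the word $\sigma=\sigma_1\cdots\sigma_{3n}$ recording S for a north step and W for an east step. For each $j$, $\tau_j$ is the level of the step listed in position $j$. Thus $\tau$ is the rank sequence of the path, nondecreasing and aligned with $\sigma$. *)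

theory Defs
  imports Main
begin

datatype step = North | East

text \<open>The letters of the sweep word: \<open>S\<close> for the south endpoint of a north step,
  \<open>W\<close> for the west endpoint of an east step.\<close>

datatype letter = S | W

text \<open>Level of the lattice point reached after the first \<open>j\<close> steps. This is also the level of the
  step \<open>P ! j\<close>, since the level of a step is that of its starting point.\<close>

definition level :: "nat \<Rightarrow> step list \<Rightarrow> nat \<Rightarrow> int" where
  "level n P j =
     2 * int n * int (count_list (take j P) North) - int n * int (count_list (take j P) East)"

text \<open>A \<open>(2n,n)\<close>-Dyck path.\<close>

definition dyck_path :: "nat \<Rightarrow> step list \<Rightarrow> bool" where
  "dyck_path n P \<longleftrightarrow>
     length P = 3 * n \<and> count_list P North = n \<and> count_list P East = 2 * n \<and>
     (\<forall>j \<le> length P. 0 \<le> level n P j)"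

text \<open>Step positions in the order in which the right-to-left sweep lists them. As \<^const>\<open>sort_key\<close>
  is stable, starting from the reversed list of positions puts the later of two steps of equal level
  first.\<close>

definition sweep_order :: "nat \<Rightarrow> step list \<Rightarrow> nat list" where
  "sweep_order n P = sort_key (level n P) (rev [0..<length P])"

fun letter_of :: "step \<Rightarrow> letter" where
  "letter_of North = S"
| "letter_of East = W"

definition sweep_map :: "nat \<Rightarrow> step list \<Rightarrow> letter list" where
  "sweep_map n P = map (\<lambda>j. letter_of (P ! j)) (sweep_order n P)"

definition rank_sequence :: "nat \<Rightarrow> step list \<Rightarrow> int list" where
  "rank_sequence n P = map (level n P) (sweep_order n P)"

end

theory Submission
  imports Defs
begin

text \<open>East steps descend by the smallest possible amount, so after a north step at a positive level
  the path must come back through that level before it ends at level \<open>0\<close>. Hence the last step at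
  each positive level is an east step. Since the sweep lists the last step of every level first, any
  increase in the rank sequence is accompanied by a letter \<open>W\<close>.\<close>

text \<open>\<open>insort_key\<close> puts \<open>x\<close> in front of all entries with the same
  key, so \<open>R x y\<close> is the only tie-breaking fact needed. Iterating this gives the
  stability of \<open>sort_key\<close>.\<close>

lemma sorted_wrt_insort_key:
  assumes "sorted_wrt (\<lambda>a b. f a < f b \<or> f a = f b \<and> R a b) xs"
    and "\<And>y. y \<in> set xs \<Longrightarrow> R x y"
  shows "sorted_wrt (\<lambda>a b. f a < f b \<or> f a = f b \<and> R a b) (insort_key f x xs)"
  using assms by (induction xs) (auto simp: set_insort_key)

lemma sorted_wrt_sort_key:
  assumes "sorted_wrt R xs"
  shows "sorted_wrt (\<lambda>a b. f a < f b \<or> f a = f b \<and> R a b) (sort_key f xs)"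
  using assms by (induction xs) (auto intro!: sorted_wrt_insort_key)

lemma set_sweep_order: "set (sweep_order n P) = {..<length P}"
  by (auto simp: sweep_order_def)

lemma length_sweep_order: "length (sweep_order n P) = length P"
  by (simp add: sweep_order_def)

lemma sorted_wrt_sweep_order:
  "sorted_wrt (\<lambda>a b. level n P a < level n P b \<or> level n P a = level n P b \<and> b < a)
     (sweep_order n P)"
  unfolding sweep_order_def by (rule sorted_wrt_sort_key) (simp add: sorted_wrt_rev)

lemma level_Suc:
  assumes "j < length P"
  shows "level n P (Suc j) =
    level n P j + (case P ! j of North \<Rightarrow> 2 * int n | East \<Rightarrow> - int n)"
  using assms by (auto simp: level_def take_Suc_conv_app_nth algebra_simps split: step.split)

lemma level_length:
  assumes "dyck_path n P"
  shows "level n P (length P) = 0"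
  using assms by (simp add: dyck_path_def level_def)

lemma dvd_level: "int n dvd level n P j"
  by (simp add: level_def)

lemma level_return:
  assumes "dyck_path n P" "p < length P" "P ! p = North" "0 < level n P p"
  shows "\<exists>q. p < q \<and> q < length P \<and> level n P q = level n P p"
proof (rule ccontr)
  assume no: "\<not> ?thesis"
  have n: "n > 0"
    using assms(1,2) by (auto simp: dyck_path_def)
  \<comment> \<open>Without a return, the path stays strictly above the level of \<open>p\<close>,
    up to and including its endpoint, where the level is \<open>0\<close>.\<close>
  have "q \<le> length P \<Longrightarrow> level n P p < level n P q" if "Suc p \<le> q" for q
    using that
  proof (induction q rule: dec_induct)
    case base
    then show ?case using assms n by (simp add: level_Suc)
  next
    case (step q)
    \<comment> \<open>Levels are multiples of \<open>n\<close>, so strictly above means at least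
      \<open>n\<close> above: an east step may land on the level of \<open>p\<close> but cannot jump
      past it.\<close>
    have "int n dvd level n P q - level n P p"
      by (intro dvd_diff dvd_level)
    with step have "int n \<le> level n P q - level n P p"
      by (intro zdvd_imp_le) auto
    then have "level n P p \<le> level n P (Suc q)"
      using step by (simp add: level_Suc split: step.split)
    moreover have "level n P (Suc q) \<noteq> level n P p"
    \<comment> \<open>The endpoint starts no step, so \<open>no\<close> does not cover it; there
      positivity of the level of \<open>p\<close> rules out equality.\<close>
    proof (cases "Suc q = length P")
      case True
      then show ?thesis using level_length[OF assms(1)] assms(4) by simp
    next
      case False
      then show ?thesis using no step by auto
    qed
    ultimately show ?case by simp
  qed
  from this[of "length P"] show False
    using assms level_length by fastforce
qed

lemma sweep_map_ascent:
  assumes "dyck_path n P" "Suc j < length P"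
    and less: "rank_sequence n P ! j < rank_sequence n P ! Suc j"
  shows "sweep_map n P ! Suc j = W"
proof -
  let ?xs = "sweep_order n P"
  define p where "p = ?xs ! Suc j"
  have lt: "level n P (?xs ! j) < level n P p"
    using less assms(2) by (simp add: rank_sequence_def length_sweep_order p_def)
  have mem: "?xs ! m < length P" if "m < length P" for m
    using that nth_mem[of m ?xs] by (simp add: set_sweep_order length_sweep_order)
  \<comment> \<open>A strict ascent from a nonnegative level ends at a positive one, as
    \<open>level_return\<close> requires.\<close>
  have "0 \<le> level n P (?xs ! j)"
    using mem[of j] assms(1,2) by (simp add: dyck_path_def)
  with lt have pos: "0 < level n P p" by simp
  have "P ! p \<noteq> North"
  proof
    assume "P ! p = North"
    then obtain q where q: "p < q" "q < length P" "level n P q = level n P p"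
      using level_return assms mem pos p_def by blast
    then obtain m where m: "m < length P" "?xs ! m = q"
      by (metis in_set_conv_nth length_sweep_order lessThan_iff set_sweep_order)
    \<comment> \<open>The later step \<open>q\<close> ties with \<open>p\<close>, so it must be
      listed before position \<open>Suc j\<close>; but every level listed there is below that of
      \<open>p\<close>.\<close>
    note sorted = sorted_wrt_nth_less[OF sorted_wrt_sweep_order[of n P]]
    consider "m < j" | "m = j" | "m = Suc j" | "Suc j < m" by linarith
    then show False
      using sorted[of m j] sorted[of "Suc j" m] lt q m assms(2)
      by cases (auto simp: length_sweep_order p_def)
  qed
  then show ?thesis
    using assms(2) by (cases "P ! p") (auto simp: sweep_map_def length_sweep_order p_def)
qed

text \<open>Ranks never decrease, and a strict increase would force the letter
  \<open>W\<close>.\<close>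

lemma rank_sequence_Suc_eq:
  assumes "dyck_path n P" "Suc j < length P" "sweep_map n P ! Suc j = S"
  shows "rank_sequence n P ! Suc j = rank_sequence n P ! j"
proof -
  have "sorted (rank_sequence n P)"
    by (simp add: rank_sequence_def sweep_order_def)
  then have "rank_sequence n P ! j \<le> rank_sequence n P ! Suc j"
    using assms(2) by (intro sorted_nth_mono) (auto simp: rank_sequence_def length_sweep_order)
  with sweep_map_ascent[OF assms(1,2)] assms(3) show ?thesis by force
qed

theorem theorem3p2:
  fixes n i :: nat and k :: int and P :: "step list"
    and \<sigma> :: "letter list" and \<tau> :: "int list"
  assumes "n \<ge> 1"
    and "dyck_path n P"
    and "\<sigma> = sweep_map n P"
    and "\<tau> = rank_sequence n P"
    and "i + 1 < 3 * n"
    and "\<sigma> ! i = W"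
    and "\<tau> ! i = k * int n"
    and "\<sigma> ! (i + 1) = S"
  shows "\<tau> ! (i + 1) = k * int n \<and>
    (i + 2 < 3 * n \<and> \<sigma> ! (i + 2) = S \<longrightarrow> \<tau> ! (i + 2) = k * int n)"
proof -
  have len: "length P = 3 * n"
    using assms(2) by (simp add: dyck_path_def)
  have "\<tau> ! (i + 1) = k * int n"
    using rank_sequence_Suc_eq[of n P i] assms len by simp
  moreover have "\<tau> ! (i + 2) = \<tau> ! (i + 1)" if "i + 2 < 3 * n" "\<sigma> ! (i + 2) = S"
    using rank_sequence_Suc_eq[of n P "Suc i"] that assms len by simp
  ultimately show ?thesis by simp
qed

end
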